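(* The following hold: (1) $\displaystyle \sum_{n=0}^\infty\frac{O_n^{(2)}}{(2n+1)^2}=\frac{\pi^4}{384}=\frac{15}{64}\zeta(4)$; (2) $\displaystyle \sum_{n=1}^\infty\frac{H_{n-1}^{(2)}}{n^2}=\frac{\pi^4}{120}=\frac34\zeta(4)$.
   Context: $\zeta$ is the Riemann zeta function. $H_n^{(2)}=\sum_{k=1}^n\frac1{k^2}$ and $O_n^{(2)}=\sum_{k=0}^{n-1}\frac{1}{(2k+1)^2}$ (for $n\ge1$ this equals $H_{2n-1}^{(2)}-\frac14H_{n-1}^{(2)}$); empty sums are $0$, so $H_0^{(2)}=O_0^{(2)}=0$. *)

theory Defs
  imports "HOL-Analysis.Analysis"
begin

definition harm2 :: "nat \<Rightarrow> real" where
  "harm2 n = (\<Sum>k=1..n. 1 / (real k)\<^sup>2)"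

definition odd_harm2 :: "nat \<Rightarrow> real" where
  "odd_harm2 n = (\<Sum>k<n. 1 / (real (2 * k + 1))\<^sup>2)"

definition zeta_series :: "complex \<Rightarrow> complex" where
  "zeta_series s = (\<Sum>n. 1 / of_nat (Suc n) powr s)"

(* The Riemann zeta function: the Dirichlet series where it converges absolutely, and elsewhere
   its analytic continuation to the plane minus the pole at 1. That continuation exists and is
   unique, so the choice is determined at every s except the pole, where the value is arbitrary. *)
definition zeta :: "complex \<Rightarrow> complex" where
  "zeta s = (if Re s > 1 then zeta_series s
     else (SOME f. f holomorphic_on - {1} \<and> (\<forall>z. Re z > 1 \<longrightarrow> f z = zeta_series z)) s)"

end

theory Submission
  imports Defs "HOL-Real_Asymp.Real_Asymp"
begin

text \<open>
  Both sums have the form \<open>e\<^sub>2 = \<Sum>n. a n * (\<Sum>k<n. a k)\<close>, the second elementary symmetric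
  function of a sequence \<open>a\<close>, and this number can be computed in two ways. On the one hand it is
  the coefficient of \<open>y\<^sup>2\<close> in the product \<open>\<Prod>k. 1 - y * a k\<close>. For
  \<open>a k = 1 / (k + 1)\<^sup>2\<close> and \<open>y = x\<^sup>2\<close> this product is Euler's \<open>sin (pi * x) / (pi * x)\<close>,
  whose Taylor expansion gives \<open>e\<^sub>2 = pi ^ 4 / 120\<close>; this is the second sum
  (\<open>inverse_squares_e2\<close>). On the other hand, squaring the series gives
  \<open>(\<Sum>n. a n)\<^sup>2 = 2 * e\<^sub>2 + (\<Sum>n. (a n)\<^sup>2)\<close> (\<open>square_of_series_sums\<close>).

  With \<open>(\<Sum>n. a n) = pi\<^sup>2 / 6\<close>, the squaring identity turns \<open>e\<^sub>2\<close> into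
  \<open>\<zeta>(4) = pi ^ 4 / 36 - pi ^ 4 / 60 = pi ^ 4 / 90\<close>. Removing the even terms multiplies
  \<open>\<zeta>(s)\<close> by \<open>1 - 1 / 2 ^ s\<close>, so the odd squares and the odd fourth powers have reciprocal sums
  \<open>pi\<^sup>2 / 8\<close> and \<open>pi ^ 4 / 96\<close>. The squaring identity for the odd squares, now read in the other
  direction, gives the first sum as \<open>(pi ^ 4 / 64 - pi ^ 4 / 96) / 2 = pi ^ 4 / 384\<close>.
\<close>

lemma prod_one_minus_eq:
  fixes a :: "nat \<Rightarrow> 'a::comm_ring_1"
  shows "(\<Prod>k<n. 1 - y * a k) = 1 - y * (\<Sum>m<n. a m * (\<Prod>k<m. 1 - y * a k))"
  by (induction n) (simp_all add: algebra_simps)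

text \<open>
  If \<open>L y\<close> is the product \<open>\<Prod>k. 1 - y * a k\<close>, then \<open>c\<close> is its second Taylor coefficient at \<open>0\<close>.
  Expanding the product twice gives
  \<open>L y = 1 - S * y + y\<^sup>2 * (\<Sum>n. a n * E y n)\<close>, where \<open>E y n\<close> is the sum
  \<open>\<Sum>m<n. a m * (\<Prod>k<m. 1 - y * a k)\<close>. As \<open>y\<close> tends to \<open>0\<close>, each \<open>E y n\<close> tends to
  \<open>\<Sum>m<n. a m\<close>. For \<open>0 < y < 1\<close> all factors of the product lie in the unit interval, hence
  \<open>0 \<le> E y n \<le> S\<close>, and Tannery's theorem permits taking the limit inside the series.
\<close>

lemma e2_sums_of_product:
  fixes a :: "nat \<Rightarrow> real"
  assumes a01: "\<And>n. 0 \<le> a n" "\<And>n. a n \<le> 1"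
    and S: "a sums S"
    and L: "\<And>y. 0 < y \<Longrightarrow> y < 1 \<Longrightarrow> (\<lambda>n. \<Prod>k<n. 1 - y * a k) \<longlonglongrightarrow> L y"
    and c: "((\<lambda>y. (S * y - 1 + L y) / y\<^sup>2) \<longlongrightarrow> c) (at_right 0)"
  shows "(\<lambda>n. a n * (\<Sum>k<n. a k)) sums c"
proof -
  define P where "P y n = (\<Prod>k<n. 1 - y * a k)" for y n
  define E where "E y n = (\<Sum>m<n. a m * P y m)" for y n
  have P_eq: "P y n = 1 - y * E y n" for y n
    unfolding P_def E_def by (rule prod_one_minus_eq)
  have partial_le: "(\<Sum>k<n. a k) \<le> S" for n
    using sum_le_suminf[OF sums_summable[OF S], of "{..<n}"] a01 sums_unique[OF S] by simp
  have factor: "0 \<le> 1 - y * a k \<and> 1 - y * a k \<le> 1" if "0 < y" "y < 1" for y k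
    using that a01[of k] mult_le_one[of y "a k"] by simp
  have P01: "0 \<le> P y n \<and> P y n \<le> 1" if "0 < y" "y < 1" for y n
    unfolding P_def using factor[OF that] by (auto intro!: prod_nonneg prod_le_1)
  have E_bound: "0 \<le> E y n \<and> E y n \<le> S" if "0 < y" "y < 1" for y n
  proof -
    have "E y n \<le> (\<Sum>k<n. a k)"
      unfolding E_def using P01[OF that] a01 by (intro sum_mono) (simp add: mult_left_le)
    moreover have "0 \<le> E y n"
      unfolding E_def using P01[OF that] a01 by (intro sum_nonneg) simp
    ultimately show ?thesis using partial_le[of n] by linarith
  qed
  have aE_sums: "(\<lambda>n. a n * E y n) sums ((S * y - 1 + L y) / y\<^sup>2)" if y: "0 < y" "y < 1" for y
  proof -
    have "(\<lambda>n. (1 - P y n) / y) \<longlonglongrightarrow> (1 - L y) / y"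
      using L[OF y] y unfolding P_def by (intro tendsto_intros) auto
    moreover have "(1 - P y n) / y = (\<Sum>m<n. a m * P y m)" for n
      using y P_eq[of y n] by (simp add: E_def)
    ultimately have "(\<lambda>n. a n * P y n) sums ((1 - L y) / y)"
      unfolding sums_def by simp
    then have "(\<lambda>n. (a n - a n * P y n) / y) sums ((S - (1 - L y) / y) / y)"
      by (intro sums_divide sums_diff S)
    moreover have "(a n - a n * P y n) / y = a n * E y n" for n
      using y by (simp add: P_eq field_simps)
    moreover have "(S - (1 - L y) / y) / y = (S * y - 1 + L y) / y\<^sup>2"
      using y by (simp add: field_simps power2_eq_square)
    ultimately show ?thesis by simp
  qed
  have small: "eventually (\<lambda>y::real. 0 < y \<and> y < 1) (at_right 0)"
    by (auto simp: eventually_at_right_field intro: exI[of _ 1])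
  have tan: "eventually (\<lambda>y. summable (\<lambda>n. norm (a n * E y n))) (at_right 0) \<and>
             summable (\<lambda>n. norm (a n * (\<Sum>k<n. a k))) \<and>
             ((\<lambda>y. \<Sum>n. a n * E y n) \<longlongrightarrow> (\<Sum>n. a n * (\<Sum>k<n. a k))) (at_right 0)"
  proof (rule tannerys_theorem)
    fix n
    have "((\<lambda>y. E y n) \<longlongrightarrow> (\<Sum>m<n. a m * (\<Prod>k<m. 1 - 0 * a k))) (at_right 0)"
      unfolding E_def P_def by (intro tendsto_intros)
    then show "((\<lambda>y. a n * E y n) \<longlongrightarrow> a n * (\<Sum>k<n. a k)) (at_right 0)"
      by (intro tendsto_intros) simp
  next
    show "eventually (\<lambda>(n, y). norm (a n * E y n) \<le> a n * S) (at_top \<times>\<^sub>F at_right 0)"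
      unfolding eventually_prod_filter
      using small a01 E_bound
      by (intro exI[of _ "\<lambda>_. True"] exI[of _ "\<lambda>y. 0 < y \<and> y < 1"])
         (auto simp: abs_mult intro!: mult_left_mono)
  next
    show "summable (\<lambda>n. a n * S)"
      using S by (intro summable_mult2) (rule sums_summable)
  qed simp
  moreover have "((\<lambda>y. \<Sum>n. a n * E y n) \<longlongrightarrow> c) (at_right 0)"
  proof (rule Lim_transform_eventually[OF c])
    show "eventually (\<lambda>y. (S * y - 1 + L y) / y\<^sup>2 = (\<Sum>n. a n * E y n)) (at_right 0)"
      using small by eventually_elim (use aE_sums sums_unique in blast)
  qed
  ultimately have "(\<Sum>n. a n * (\<Sum>k<n. a k)) = c"
    using tendsto_unique by (metis trivial_limit_at_right_real)
  then show ?thesis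
    using tan summable_norm_cancel sums_iff by blast
qed

lemma inverse_squares_e2:
  "(\<lambda>n. 1 / (real (Suc n))\<^sup>2 * (\<Sum>k<n. 1 / (real (Suc k))\<^sup>2)) sums (pi ^ 4 / 120)"
proof (rule e2_sums_of_product)
  show "(\<lambda>n. 1 / (real (Suc n))\<^sup>2) sums (pi\<^sup>2 / 6)"
    using inverse_squares_sums by (simp add: add.commute)
  show "(\<lambda>n. \<Prod>k<n. 1 - y * (1 / (real (Suc k))\<^sup>2)) \<longlonglongrightarrow> sin (pi * sqrt y) / (pi * sqrt y)"
    if "0 < y" for y
  proof -
    have "(\<Prod>k=1..n. 1 - (sqrt y)\<^sup>2 / (real k)\<^sup>2) = (\<Prod>k<n. 1 - y * (1 / (real (Suc k))\<^sup>2))" for n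
      using that by (intro prod.reindex_bij_witness[of _ Suc "\<lambda>k. k - 1"]) auto
    then show ?thesis
      using sin_product_formula_real'[of "sqrt y"] that by simp
  qed
  show "((\<lambda>y. (pi\<^sup>2 / 6 * y - 1 + sin (pi * sqrt y) / (pi * sqrt y)) / y\<^sup>2) \<longlongrightarrow> pi ^ 4 / 120)
        (at_right 0)"
  proof -
    (* In terms of z = pi * sqrt y this is the coefficient of z^4 in sin z / z. *)
    have "((\<lambda>z::real. (z\<^sup>2 / 6 - 1 + sin z / z) / z ^ 4) \<longlongrightarrow> 1 / 120) (at_right 0)"
      by real_asymp
    moreover have "filterlim (\<lambda>y. pi * sqrt y) (at_right 0) (at_right 0)"
      by real_asymp
    ultimately have "((\<lambda>y. ((pi * sqrt y)\<^sup>2 / 6 - 1 + sin (pi * sqrt y) / (pi * sqrt y)) /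
        (pi * sqrt y) ^ 4) \<longlongrightarrow> 1 / 120) (at_right 0)"
      by (rule filterlim_compose)
    from tendsto_mult_left[OF this, of "pi ^ 4"]
    have lim: "((\<lambda>y. pi ^ 4 * (((pi * sqrt y)\<^sup>2 / 6 - 1 + sin (pi * sqrt y) / (pi * sqrt y)) /
        (pi * sqrt y) ^ 4)) \<longlongrightarrow> pi ^ 4 / 120) (at_right 0)"
      by simp
    have sqrt_power4: "sqrt y ^ 4 = y\<^sup>2" if "0 < y" for y
      using that power_mult[of "sqrt y" 2 2] by simp
    show ?thesis
    proof (rule Lim_transform_eventually[OF lim])
      show "eventually (\<lambda>y. pi ^ 4 * (((pi * sqrt y)\<^sup>2 / 6 - 1 + sin (pi * sqrt y) / (pi * sqrt y)) /
          (pi * sqrt y) ^ 4) = (pi\<^sup>2 / 6 * y - 1 + sin (pi * sqrt y) / (pi * sqrt y)) / y\<^sup>2)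
          (at_right 0)"
        using eventually_at_right_less[of 0]
        by eventually_elim (simp add: power_mult_distrib sqrt_power4)
    qed
  qed
qed (simp_all add: field_simps)

text \<open>
  Expanding the square of a partial sum collects each product of two distinct terms twice and the
  square of each term once.
\<close>

lemma square_of_series_sums:
  fixes a :: "nat \<Rightarrow> real"
  assumes "a sums S"
  shows "(\<lambda>n. 2 * (a n * (\<Sum>k<n. a k)) + (a n)\<^sup>2) sums S\<^sup>2"
proof -
  have "(\<Sum>m<n. 2 * (a m * (\<Sum>k<m. a k)) + (a m)\<^sup>2) = (\<Sum>k<n. a k)\<^sup>2" for n
    by (induction n) (simp_all add: power2_eq_square algebra_simps)
  then show ?thesis
    using assms unfolding sums_def by (simp add: tendsto_power)
qed

lemma inverse_fourth_powers_sums: "(\<lambda>n. 1 / real (Suc n) ^ 4) sums (pi ^ 4 / 90)"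
proof -
  let ?a = "\<lambda>n. 1 / (real (Suc n))\<^sup>2"
  have "?a sums (pi\<^sup>2 / 6)"
    using inverse_squares_sums by (simp add: add.commute)
  from sums_diff[OF square_of_series_sums[OF this] sums_mult[OF inverse_squares_e2, of 2]]
  have "(\<lambda>n. (?a n)\<^sup>2) sums ((pi\<^sup>2 / 6)\<^sup>2 - 2 * (pi ^ 4 / 120))"
    by simp
  moreover have "(pi\<^sup>2 / 6)\<^sup>2 - 2 * (pi ^ 4 / 120) = pi ^ 4 / 90"
    by (simp add: power_divide)
  ultimately show ?thesis
    by (simp add: power_divide)
qed

text \<open>
  The even terms of \<open>\<Sum>n. 1 / n ^ s\<close> form a copy of the whole series scaled by \<open>1 / 2 ^ s\<close>.
\<close>

lemma odd_inverse_powers_sums: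
  assumes "(\<lambda>n. 1 / real (Suc n) ^ s) sums Z"
  shows "(\<lambda>n. 1 / real (2 * n + 1) ^ s) sums ((1 - 1 / 2 ^ s) * Z)"
proof -
  let ?f = "\<lambda>n. 1 / real (Suc n) ^ s"
  have "(\<lambda>n. sum ?f {n * 2..<n * 2 + 2}) sums Z"
    by (rule sums_group[OF assms]) simp
  moreover have "sum ?f {n * 2..<n * 2 + 2} = ?f (2 * n) + ?f (2 * n + 1)" for n
    by (simp add: numeral_2_eq_2 mult.commute)
  ultimately have all: "(\<lambda>n. ?f (2 * n) + ?f (2 * n + 1)) sums Z"
    by simp
  have even_eq: "?f (2 * n + 1) = 1 / 2 ^ s * ?f n" for n
  proof -
    have "real (Suc (2 * n + 1)) = 2 * real (Suc n)" by simp
    then show ?thesis by (simp only: power_mult_distrib) simp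
  qed
  have "(\<lambda>n. ?f (2 * n + 1)) sums (1 / 2 ^ s * Z)"
    unfolding even_eq by (rule sums_mult[OF assms])
  from sums_diff[OF all this] show ?thesis
    by (simp add: algebra_simps)
qed

lemma odd_inverse_squares_e2:
  "(\<lambda>n. 1 / (real (2 * n + 1))\<^sup>2 * (\<Sum>k<n. 1 / (real (2 * k + 1))\<^sup>2)) sums (pi ^ 4 / 384)"
proof -
  let ?a = "\<lambda>n. 1 / (real (2 * n + 1))\<^sup>2"
  have "(\<lambda>n. 1 / (real (Suc n))\<^sup>2) sums (pi\<^sup>2 / 6)"
    using inverse_squares_sums by (simp add: add.commute)
  from square_of_series_sums[OF odd_inverse_powers_sums[OF this]]
  have "(\<lambda>n. 2 * (?a n * (\<Sum>k<n. ?a k)) + (?a n)\<^sup>2) sums ((1 - 1 / 2\<^sup>2) * (pi\<^sup>2 / 6))\<^sup>2" .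
  moreover have "(\<lambda>n. (?a n)\<^sup>2) sums ((1 - 1 / 2 ^ 4) * (pi ^ 4 / 90))"
    using odd_inverse_powers_sums[OF inverse_fourth_powers_sums] by (simp add: power_divide)
  ultimately have "(\<lambda>n. 2 * (?a n * (\<Sum>k<n. ?a k)) + (?a n)\<^sup>2 - (?a n)\<^sup>2) sums
      (((1 - 1 / 2\<^sup>2) * (pi\<^sup>2 / 6))\<^sup>2 - (1 - 1 / 2 ^ 4) * (pi ^ 4 / 90))"
    by (rule sums_diff)
  from sums_divide[OF this, of 2]
  have "(\<lambda>n. ?a n * (\<Sum>k<n. ?a k)) sums
      ((((1 - 1 / 2\<^sup>2) * (pi\<^sup>2 / 6))\<^sup>2 - (1 - 1 / 2 ^ 4) * (pi ^ 4 / 90)) / 2)"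
    by simp
  moreover have "(((1 - 1 / 2\<^sup>2) * (pi\<^sup>2 / 6))\<^sup>2 - (1 - 1 / 2 ^ 4) * (pi ^ 4 / 90)) / 2
      = pi ^ 4 / 384"
    by (simp add: power_mult_distrib power_divide)
  ultimately show ?thesis by (simp only:)
qed

lemma zeta_4: "zeta 4 = complex_of_real (pi ^ 4 / 90)"
proof -
  have "1 / of_nat (Suc n) powr (4::complex) = complex_of_real (1 / real (Suc n) ^ 4)" for n
    using powr_nat'[of "of_nat (Suc n) :: complex" 4] by (simp del: of_nat_Suc)
  then have "(\<lambda>n. 1 / of_nat (Suc n) powr (4::complex)) sums complex_of_real (pi ^ 4 / 90)"
    using sums_of_real[OF inverse_fourth_powers_sums, where 'a = complex] by simp
  then show ?thesis
    by (simp add: zeta_def zeta_series_def sums_iff)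
qed

theorem theorem4p4:
  shows "(\<lambda>n. odd_harm2 n / (real (2 * n + 1))\<^sup>2) sums (pi ^ 4 / 384)
      \<and> complex_of_real (pi ^ 4 / 384) = 15 / 64 * zeta 4
      \<and> (\<lambda>n. harm2 (Suc n - 1) / (real (Suc n))\<^sup>2) sums (pi ^ 4 / 120)
      \<and> complex_of_real (pi ^ 4 / 120) = 3 / 4 * zeta 4"
proof (intro conjI)
  show "(\<lambda>n. odd_harm2 n / (real (2 * n + 1))\<^sup>2) sums (pi ^ 4 / 384)"
    using odd_inverse_squares_e2 by (simp add: odd_harm2_def)
  have "harm2 n = (\<Sum>k<n. 1 / (real (Suc k))\<^sup>2)" for n
    unfolding harm2_def by (intro sum.reindex_bij_witness[of _ Suc "\<lambda>k. k - 1"]) auto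
  then show "(\<lambda>n. harm2 (Suc n - 1) / (real (Suc n))\<^sup>2) sums (pi ^ 4 / 120)"
    using inverse_squares_e2 by simp
qed (simp_all add: zeta_4)

end
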